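(* Let $(X,\tau,E)$, $(Y,\tau',E)$ and $(Z,\tau'',E)$ be soft topological spaces over the same parameter set $E$, let $Y^Z$ carry the pointwise soft topology, and suppose that the mapping $e:Y^Z\times Z\to Y$, $e(f,z)=f(z)$, is soft continuous. Then for each soft continuous mapping $\hat g:X\to Y^Z$, the mapping $$E^{-1}(\hat g):Z\times X\to Y,\qquad E^{-1}(\hat g)(z,x)=\hat g(x)(z),$$ is also soft continuous.
   Context: Soft sets: a soft set $(F,E)$ over a set $X$ is a map $F:E\to P(X)$ into the power set of $X$. Inclusions, unions and intersections of soft sets with the same parameter set $E$ are taken parameterwise: $(F,E)\subset(G,E)$ means $F(e)\subset G(e)$ for all $e\in E$, and $(F\cup G)(e)=F(e)\cup G(e)$, $(F\cap G)(e)=F(e)\cap G(e)$, similarly for arbitrary families. $\Phi$ is the soft set with $\Phi(e)=\varnothing$ for all $e\in E$, and $\widetilde X$ is the soft set with $\widetilde X(e)=X$ for all $e\in E$. Soft topology: a soft topology on $X$ (with parameter set $E$) is a collection $\tau$ of soft sets $(F,E)$ over $X$ that contains $\Phi$ and $\widetilde X$ and is closed under arbitrary unions and under intersections of two members; $(X,\tau,E)$ is then a soft topological space and the members of $\tau$ are its soft open sets. A subbase of $\tau$ is a subcollection whose finite intersections form a base, i.e. every member of $\tau$ is a union of such finite intersections. Soft points: for $x\in X$, $\alpha\in E$, the soft point $x_\alpha$ is the soft set with value $\{x\}$ at $\alpha$ and $\varnothing$ at all other parameters; $x_\alpha\in(F,E)$ means $x\in F(\alpha)$. A soft set $(F,E)$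 is a soft neighbourhood of $x_\alpha$ if there is a soft open $(G,E)$ with $x_\alpha\in(G,E)\subset(F,E)$. Soft mappings: a soft mapping $f=(f,1_E):(X,\tau,E)\to(Y,\tau',E)$ is given by a map $f:X\to Y$ together with the identity of $E$; it sends $x_\alpha$ to $f(x)_\alpha$, the image of $(F,E)$ is $\alpha\mapsto f(F(\alpha))$ and the preimage of $(G,E)$ is $\alpha\mapsto f^{-1}(G(\alpha))$. It is soft continuous if for every soft point $x_\alpha$ of $X$ and every soft neighbourhood $(H,E)$ of $f(x)_\alpha$ there is a soft neighbourhood $(F,E)$ of $x_\alpha$ with $f((F,E))\subset(H,E)$. Product: the product of two soft topological spaces $(Z_1,\eta_1,E)$, $(Z_2,\eta_2,E)$ is $Z_1\times Z_2$ with the same parameter set $E$ and the soft topology having as subbase the soft sets $\alpha\mapsto F_1(\alpha)\times Z_2$ with $(F_1,E)\in\eta_1$ and $\alpha\mapsto Z_1\times F_2(\alpha)$ with $(F_2,E)\in\eta_2$. The spaces $Y^Z\times Z$ and $Z\times X$ carry these product soft topologies. Function space: $Y^Z$ denotes the set of all soft continuous mappings $(f,1_E):(Z,\tau'',E)\to(Y,\tau',E)$. For a soft point $z_\alpha$ of $Z$ the evaluation map $e_{z_\alpha}:(Y^Z,E)\to(Y,\tau',E)$ is the soft mapping given by $f\mapsto f(z)$ and the identity on $E$, so that $e_{z_\alpha}^{-1}(G,E)$ is the soft set $\beta\mapsto\{f\in Y^Z: f(z)\in G(\beta)\}$ over $Y^Z$. The pointwise soft topology $\tau_p$ on $Y^Z$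 is the soft topology with subbase $\{e_{z_\alpha}^{-1}(G,E): z\in Z,\ \alpha\in E,\ (G,E)\in\tau'\}$. The symbol $E^{-1}$ in $E^{-1}(\hat g)$ denotes the inverse of the exponential law, defined by the displayed formula in the claim; it is unrelated to the parameter set $E$. *)

theory Defs
  imports Main "HOL-Library.FuncSet"
begin

text \<open>
  A soft set over \<open>X\<close> with parameter set \<open>E\<close>, i.e. a map from \<open>E\<close> to the power set of \<open>X\<close>, is
  represented by the total function that extends it by the empty set outside \<open>E\<close>. This makes the
  representation unique, and inclusion, (arbitrary) union and binary intersection of soft sets are
  the pointwise \<open>\<le>\<close>, \<^const>\<open>Sup\<close> and \<^const>\<open>inf\<close> of the library; \<open>bot\<close> is the empty soft set.
\<close>

type_synonym ('e, 'a) soft = "'e \<Rightarrow> 'a set"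

definition soft_set :: "'e set \<Rightarrow> 'a set \<Rightarrow> ('e, 'a) soft \<Rightarrow> bool" where
  "soft_set E X F \<longleftrightarrow> (\<forall>e\<in>E. F e \<subseteq> X) \<and> (\<forall>e. e \<notin> E \<longrightarrow> F e = {})"

definition soft_whole :: "'e set \<Rightarrow> 'a set \<Rightarrow> ('e, 'a) soft" where
  "soft_whole E X = (\<lambda>e. if e \<in> E then X else {})"

definition soft_topology :: "'e set \<Rightarrow> 'a set \<Rightarrow> ('e, 'a) soft set \<Rightarrow> bool" where
  "soft_topology E X \<tau> \<longleftrightarrow>
     (\<forall>F\<in>\<tau>. soft_set E X F) \<and>
     bot \<in> \<tau> \<and> soft_whole E X \<in> \<tau> \<and>
     (\<forall>\<A>. \<A> \<subseteq> \<tau> \<longrightarrow> Sup \<A> \<in> \<tau>) \<and>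
     (\<forall>F\<in>\<tau>. \<forall>G\<in>\<tau>. inf F G \<in> \<tau>)"

text \<open>
  The meet with the whole soft set only matters for the empty family, whose intersection is by
  convention the whole soft set.
\<close>

definition soft_finite_inters :: "'e set \<Rightarrow> 'a set \<Rightarrow> ('e, 'a) soft set \<Rightarrow> ('e, 'a) soft set" where
  "soft_finite_inters E X S = {inf (soft_whole E X) (Inf \<F>) | \<F>. finite \<F> \<and> \<F> \<subseteq> S}"

definition soft_subbase ::
    "'e set \<Rightarrow> 'a set \<Rightarrow> ('e, 'a) soft set \<Rightarrow> ('e, 'a) soft set \<Rightarrow> bool" where
  "soft_subbase E X S \<tau> \<longleftrightarrow>
     S \<subseteq> \<tau> \<and> (\<forall>F\<in>\<tau>. \<exists>\<B>. \<B> \<subseteq> soft_finite_inters E X S \<and> F = Sup \<B>)"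

definition soft_generated :: "'e set \<Rightarrow> 'a set \<Rightarrow> ('e, 'a) soft set \<Rightarrow> ('e, 'a) soft set" where
  "soft_generated E X S = {Sup \<B> | \<B>. \<B> \<subseteq> soft_finite_inters E X S}"

text \<open>
  The soft point of \<open>x\<close> at \<open>\<alpha>\<close> is given by the two arguments \<open>x\<close> and \<open>\<alpha>\<close>, and it belongs to
  a soft set \<open>F\<close> iff \<open>x \<in> F \<alpha>\<close>.
\<close>

definition soft_nhd ::
    "'e set \<Rightarrow> 'a set \<Rightarrow> ('e, 'a) soft set \<Rightarrow> 'a \<Rightarrow> 'e \<Rightarrow> ('e, 'a) soft \<Rightarrow> bool" where
  "soft_nhd E X \<tau> x \<alpha> F \<longleftrightarrow> soft_set E X F \<and> (\<exists>G\<in>\<tau>. x \<in> G \<alpha> \<and> G \<le> F)"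

definition soft_image :: "('a \<Rightarrow> 'b) \<Rightarrow> ('e, 'a) soft \<Rightarrow> ('e, 'b) soft" where
  "soft_image f F = (\<lambda>\<alpha>. f ` F \<alpha>)"

definition soft_preimage :: "'a set \<Rightarrow> ('a \<Rightarrow> 'b) \<Rightarrow> ('e, 'b) soft \<Rightarrow> ('e, 'a) soft" where
  "soft_preimage X f G = (\<lambda>\<alpha>. {x \<in> X. f x \<in> G \<alpha>})"

definition soft_continuous ::
    "'e set \<Rightarrow> 'a set \<Rightarrow> ('e, 'a) soft set \<Rightarrow> 'b set \<Rightarrow> ('e, 'b) soft set \<Rightarrow> ('a \<Rightarrow> 'b) \<Rightarrow> bool" where
  "soft_continuous E X \<tau> Y \<tau>' f \<longleftrightarrow>
     f \<in> X \<rightarrow> Y \<and>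
     (\<forall>x\<in>X. \<forall>\<alpha>\<in>E. \<forall>H. soft_nhd E Y \<tau>' (f x) \<alpha> H \<longrightarrow>
        (\<exists>F. soft_nhd E X \<tau> x \<alpha> F \<and> soft_image f F \<le> H))"

definition soft_prod_topology ::
    "'e set \<Rightarrow> 'a set \<Rightarrow> ('e, 'a) soft set \<Rightarrow> 'b set \<Rightarrow> ('e, 'b) soft set \<Rightarrow> ('e, 'a \<times> 'b) soft set" where
  "soft_prod_topology E Z\<^sub>1 \<eta>\<^sub>1 Z\<^sub>2 \<eta>\<^sub>2 =
     soft_generated E (Z\<^sub>1 \<times> Z\<^sub>2)
       ({(\<lambda>\<alpha>. F\<^sub>1 \<alpha> \<times> Z\<^sub>2) | F\<^sub>1. F\<^sub>1 \<in> \<eta>\<^sub>1} \<union> {(\<lambda>\<alpha>. Z\<^sub>1 \<times> F\<^sub>2 \<alpha>) | F\<^sub>2. F\<^sub>2 \<in> \<eta>\<^sub>2})"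

text \<open>Maps on \<open>Z\<close> are taken to be extensional, so that each of them is a single function.\<close>

definition soft_maps ::
    "'e set \<Rightarrow> 'c set \<Rightarrow> ('e, 'c) soft set \<Rightarrow> 'b set \<Rightarrow> ('e, 'b) soft set \<Rightarrow> ('c \<Rightarrow> 'b) set" where
  "soft_maps E Z \<tau>'' Y \<tau>' = {f \<in> Z \<rightarrow>\<^sub>E Y. soft_continuous E Z \<tau>'' Y \<tau>' f}"

text \<open>The evaluation at the soft point of \<open>z\<close> at \<open>\<alpha>\<close> does not depend on \<open>\<alpha>\<close>.\<close>

definition soft_pointwise ::
    "'e set \<Rightarrow> 'c set \<Rightarrow> ('e, 'c) soft set \<Rightarrow> 'b set \<Rightarrow> ('e, 'b) soft set \<Rightarrow> ('e, 'c \<Rightarrow> 'b) soft set" where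
  "soft_pointwise E Z \<tau>'' Y \<tau>' =
     soft_generated E (soft_maps E Z \<tau>'' Y \<tau>')
       {soft_preimage (soft_maps E Z \<tau>'' Y \<tau>') (\<lambda>f. f z) G | z \<alpha> G. z \<in> Z \<and> \<alpha> \<in> E \<and> G \<in> \<tau>'}"

definition exp_inverse :: "('a \<Rightarrow> 'c \<Rightarrow> 'b) \<Rightarrow> 'c \<times> 'a \<Rightarrow> 'b" where
  "exp_inverse g = (\<lambda>(z, x). g x z)"

lemma soft_finite_inters_inf:
  assumes "F \<in> soft_finite_inters E X S" "G \<in> soft_finite_inters E X S"
  shows "inf F G \<in> soft_finite_inters E X S"
proof -
  obtain \<F> \<G> where "finite \<F>" "\<F> \<subseteq> S" "F = inf (soft_whole E X) (Inf \<F>)"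
    and "finite \<G>" "\<G> \<subseteq> S" "G = inf (soft_whole E X) (Inf \<G>)"
    using assms unfolding soft_finite_inters_def by blast
  moreover from this have "inf F G = inf (soft_whole E X) (Inf (\<F> \<union> \<G>))"
    by (simp add: Inf_union_distrib inf.left_commute inf.assoc)
  ultimately show ?thesis
    unfolding soft_finite_inters_def by (intro CollectI exI[of _ "\<F> \<union> \<G>"]) simp
qed

lemma soft_topology_generated: "soft_topology E X (soft_generated E X S)"
  unfolding soft_topology_def
proof (intro conjI ballI allI impI)
  fix F assume "F \<in> soft_generated E X S"
  then obtain \<B> where B: "\<B> \<subseteq> soft_finite_inters E X S" "F = Sup \<B>"
    unfolding soft_generated_def by blast
  have "b \<le> soft_whole E X" if "b \<in> \<B>" for b
    using that B unfolding soft_finite_inters_def by auto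
  then have "F \<le> soft_whole E X" using B by (simp add: Sup_least)
  then show "soft_set E X F"
    unfolding soft_set_def le_fun_def soft_whole_def by (metis subset_empty)
next
  show "bot \<in> soft_generated E X S"
    unfolding soft_generated_def by (intro CollectI exI[of _ "{}"]) simp
next
  have "soft_whole E X \<in> soft_finite_inters E X S"
    unfolding soft_finite_inters_def by (intro CollectI exI[of _ "{}"]) simp
  then show "soft_whole E X \<in> soft_generated E X S"
    unfolding soft_generated_def by (intro CollectI exI[of _ "{soft_whole E X}"]) simp
next
  fix \<A> assume A: "\<A> \<subseteq> soft_generated E X S"
  let ?B = "{b \<in> soft_finite_inters E X S. b \<le> Sup \<A>}"
  have "a \<le> Sup ?B" if a: "a \<in> \<A>" for a
  proof -
    obtain \<B> where B: "\<B> \<subseteq> soft_finite_inters E X S" "a = Sup \<B>"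
      using A a unfolding soft_generated_def by blast
    have "b \<le> Sup \<A>" if "b \<in> \<B>" for b
      using order_trans[OF Sup_upper[OF that]] Sup_upper[OF a] B(2) by metis
    then have "\<B> \<subseteq> ?B" using B(1) by blast
    then show ?thesis unfolding B(2) by (rule Sup_subset_mono)
  qed
  then have "Sup \<A> = Sup ?B" 
    by (intro antisym) (simp_all only: Sup_le_iff mem_Collect_eq, simp_all)
  then show "Sup \<A> \<in> soft_generated E X S" unfolding soft_generated_def by blast
next
  fix F G assume "F \<in> soft_generated E X S" "G \<in> soft_generated E X S"
  then obtain \<B> \<C> where B: "\<B> \<subseteq> soft_finite_inters E X S" "F = Sup \<B>"
    and C: "\<C> \<subseteq> soft_finite_inters E X S" "G = Sup \<C>"
    unfolding soft_generated_def by blast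
  have "inf F G = Sup {inf b c | b c. b \<in> \<B> \<and> c \<in> \<C>}"
  proof (intro ext set_eqI iffI)
    fix e x assume "x \<in> inf F G e"
    then obtain b c where "b \<in> \<B>" "c \<in> \<C>" "x \<in> inf b c e" using B C by auto
    then show "x \<in> Sup {inf b c | b c. b \<in> \<B> \<and> c \<in> \<C>} e"
      unfolding Sup_apply by blast
  next
    fix e x assume "x \<in> Sup {inf b c | b c. b \<in> \<B> \<and> c \<in> \<C>} e"
    then show "x \<in> inf F G e" using B C by auto
  qed
  moreover have "{inf b c | b c. b \<in> \<B> \<and> c \<in> \<C>} \<subseteq> soft_finite_inters E X S"
    using B C by (auto intro: soft_finite_inters_inf)
  ultimately show "inf F G \<in> soft_generated E X S" unfolding soft_generated_def by blast
qed

lemma soft_subbase_generated: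
  assumes "\<And>F. F \<in> S \<Longrightarrow> soft_set E X F"
  shows "soft_subbase E X S (soft_generated E X S)"
  unfolding soft_subbase_def
proof (intro conjI subsetI ballI)
  fix F assume F: "F \<in> S"
  have "F \<le> soft_whole E X"
    using assms[OF F] by (auto simp: soft_set_def soft_whole_def le_fun_def)
  then have "F = inf (soft_whole E X) (Inf {F})" by (simp add: inf.absorb2)
  then have "F \<in> soft_finite_inters E X S"
    unfolding soft_finite_inters_def using F by (intro CollectI exI[of _ "{F}"]) simp
  then show "F \<in> soft_generated E X S"
    unfolding soft_generated_def by (intro CollectI exI[of _ "{F}"]) simp
qed (auto simp: soft_generated_def)

lemma soft_finite_inters_in_topology:
  assumes \<tau>: "soft_topology E X \<tau>" and "S \<subseteq> \<tau>"
  shows "soft_finite_inters E X S \<subseteq> \<tau>"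
proof -
  have "inf (soft_whole E X) (Inf \<F>) \<in> \<tau>" if "finite \<F>" "\<F> \<subseteq> S" for \<F>
    using that
  proof (induction rule: finite_induct)
    case empty
    then show ?case using \<tau> by (simp add: soft_topology_def)
  next
    case (insert F \<F>)
    then have "inf F (inf (soft_whole E X) (Inf \<F>)) \<in> \<tau>"
      using \<tau> \<open>S \<subseteq> \<tau>\<close> unfolding soft_topology_def by blast
    then show ?case by (simp only: Inf_insert inf.left_commute)
  qed
  then show ?thesis unfolding soft_finite_inters_def by blast
qed

lemma soft_topology_eq_generated:
  assumes \<tau>: "soft_topology E X \<tau>" and S: "soft_subbase E X S \<tau>"
  shows "\<tau> = soft_generated E X S"
proof -
  have "soft_finite_inters E X S \<subseteq> \<tau>"
    using soft_finite_inters_in_topology[OF \<tau>] S unfolding soft_subbase_def by blast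
  then have "soft_generated E X S \<subseteq> \<tau>"
    using \<tau> unfolding soft_topology_def soft_generated_def by blast
  moreover have "\<tau> \<subseteq> soft_generated E X S"
    using S unfolding soft_subbase_def soft_generated_def by blast
  ultimately show ?thesis by blast
qed

end

theory Submission
  imports Defs
begin

text \<open>
  The inverse exponential law factors through evaluation: writing \<open>W\<close> for the space of soft
  continuous maps, \<open>exp_inverse g\<close> sends \<open>(z, x)\<close> first to \<open>(g x, z) \<in> W \<times> Z\<close> and then to
  \<open>g x z\<close>. The second step is continuous by hypothesis, so, by \<open>soft_continuous_compose\<close>, the
  issue is the continuity of \<open>(z, x) \<mapsto> (g x, z)\<close>. This is \<open>soft_continuous_swap_prod\<close>:
  the boxes \<open>\<alpha> \<mapsto> F \<alpha> \<times> G \<alpha>\<close> with \<open>F\<close> and \<open>G\<close>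
  soft open form a base of the product (\<open>soft_box_open\<close>, \<open>soft_prod_open_contains_box\<close>), and a
  box \<open>F \<times> G\<close> around \<open>(g x, z)\<close> receives the box \<open>G \<times> K\<close> around \<open>(z, x)\<close> as soon as \<open>g\<close> sends the
  soft open set \<open>K\<close> into \<open>F\<close>.
\<close>

lemma soft_open_subset:
  assumes "soft_topology E X \<tau>" "F \<in> \<tau>"
  shows "F \<alpha> \<subseteq> X"
  using assms unfolding soft_topology_def soft_set_def by (metis empty_subsetI)

lemma soft_open_param:
  assumes "soft_topology E X \<tau>" "F \<in> \<tau>" "x \<in> F \<alpha>"
  shows "\<alpha> \<in> E"
  using assms unfolding soft_topology_def soft_set_def by (metis empty_iff)

lemma soft_nhd_open:
  assumes "soft_topology E X \<tau>" "F \<in> \<tau>" "x \<in> F \<alpha>"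
  shows "soft_nhd E X \<tau> x \<alpha> F"
  using assms unfolding soft_nhd_def soft_topology_def by blast

text \<open>
  Neighbourhoods may be shrunk in the domain and enlarged in the codomain, so soft continuity can
  be tested on soft open sets on both sides.
\<close>

lemma soft_continuous_iff_open:
  assumes \<tau>: "soft_topology E X \<tau>" and \<sigma>: "soft_topology E Y \<sigma>"
  shows "soft_continuous E X \<tau> Y \<sigma> f \<longleftrightarrow>
    f \<in> X \<rightarrow> Y \<and>
    (\<forall>x\<in>X. \<forall>\<alpha>. \<forall>G\<in>\<sigma>. f x \<in> G \<alpha> \<longrightarrow> (\<exists>F\<in>\<tau>. x \<in> F \<alpha> \<and> soft_image f F \<le> G))"
    (is "_ \<longleftrightarrow> _ \<and> ?open")
proof (intro iffI conjI ballI allI impI)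
  assume "soft_continuous E X \<tau> Y \<sigma> f"
  then show "f \<in> X \<rightarrow> Y" unfolding soft_continuous_def by blast
next
  fix x \<alpha> G
  assume f: "soft_continuous E X \<tau> Y \<sigma> f" and x: "x \<in> X" and G: "G \<in> \<sigma>" "f x \<in> G \<alpha>"
  obtain F where "soft_nhd E X \<tau> x \<alpha> F" and FG: "soft_image f F \<le> G"
    using f x soft_open_param[OF \<sigma> G] soft_nhd_open[OF \<sigma> G] unfolding soft_continuous_def by blast
  then obtain F' where "F' \<in> \<tau>" "x \<in> F' \<alpha>" and F': "F' \<le> F"
    unfolding soft_nhd_def by blast
  moreover have "soft_image f F' \<le> G"
    using F' FG unfolding soft_image_def le_fun_def by blast
  ultimately show "\<exists>F\<in>\<tau>. x \<in> F \<alpha> \<and> soft_image f F \<le> G" by blast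
next
  assume *: "f \<in> X \<rightarrow> Y \<and> ?open"
  show "soft_continuous E X \<tau> Y \<sigma> f"
    unfolding soft_continuous_def
  proof (intro conjI ballI allI impI)
    fix x \<alpha> H assume "x \<in> X" and H: "soft_nhd E Y \<sigma> (f x) \<alpha> H"
    then obtain G where "G \<in> \<sigma>" "f x \<in> G \<alpha>" and GH: "G \<le> H"
      unfolding soft_nhd_def by blast
    then obtain F where F: "F \<in> \<tau>" "x \<in> F \<alpha>" and FG: "soft_image f F \<le> G"
      using * \<open>x \<in> X\<close> by blast
    show "\<exists>F. soft_nhd E X \<tau> x \<alpha> F \<and> soft_image f F \<le> H"
      using soft_nhd_open[OF \<tau> F] order_trans[OF FG GH] by blast
  qed (use * in blast)
qed

lemma soft_continuous_compose:
  assumes "soft_continuous E X \<tau> Y \<sigma> f" and "soft_continuous E Y \<sigma> W \<rho> h"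
  shows "soft_continuous E X \<tau> W \<rho> (h \<circ> f)"
  unfolding soft_continuous_def
proof (intro conjI ballI allI impI)
  show "h \<circ> f \<in> X \<rightarrow> W"
    using assms unfolding soft_continuous_def by auto
next
  fix x \<alpha> H
  assume x: "x \<in> X" and \<alpha>: "\<alpha> \<in> E" and H: "soft_nhd E W \<rho> ((h \<circ> f) x) \<alpha> H"
  have "f x \<in> Y" using assms(1) x unfolding soft_continuous_def by blast
  then obtain G where G: "soft_nhd E Y \<sigma> (f x) \<alpha> G" "soft_image h G \<le> H"
    using assms(2) \<alpha> H unfolding soft_continuous_def by fastforce
  then obtain F where F: "soft_nhd E X \<tau> x \<alpha> F" "soft_image f F \<le> G"
    using assms(1) x \<alpha> unfolding soft_continuous_def by blast
  have "soft_image (h \<circ> f) F \<le> H"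
    using F(2) G(2) unfolding soft_image_def le_fun_def by fastforce
  then show "\<exists>F. soft_nhd E X \<tau> x \<alpha> F \<and> soft_image (h \<circ> f) F \<le> H"
    using F(1) by blast
qed

lemma soft_topology_prod: "soft_topology E (Z \<times> W) (soft_prod_topology E Z \<eta> W \<theta>)"
  unfolding soft_prod_topology_def by (rule soft_topology_generated)

text \<open>
  A box is the intersection of its two cylinders \<open>F \<times> W\<close> and \<open>Z \<times> G\<close>, which belong to the subbase.
\<close>

lemma soft_box_open:
  assumes \<eta>: "soft_topology E Z \<eta>" and \<theta>: "soft_topology E W \<theta>"
    and F: "F \<in> \<eta>" and G: "G \<in> \<theta>"
  shows "(\<lambda>\<alpha>. F \<alpha> \<times> G \<alpha>) \<in> soft_prod_topology E Z \<eta> W \<theta>"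
proof -
  let ?S = "{(\<lambda>\<alpha>. F \<alpha> \<times> W) | F. F \<in> \<eta>} \<union> {(\<lambda>\<alpha>. Z \<times> G \<alpha>) | G. G \<in> \<theta>}"
  have left: "soft_set E (Z \<times> W) (\<lambda>\<alpha>. F \<alpha> \<times> W)" if "F \<in> \<eta>" for F
    using soft_open_subset[OF \<eta> that] soft_open_param[OF \<eta> that]
    unfolding soft_set_def by auto
  have right: "soft_set E (Z \<times> W) (\<lambda>\<alpha>. Z \<times> G \<alpha>)" if "G \<in> \<theta>" for G
    using soft_open_subset[OF \<theta> that] soft_open_param[OF \<theta> that]
    unfolding soft_set_def by auto
  have "soft_set E (Z \<times> W) C" if "C \<in> ?S" for C
    using that by (elim UnE CollectE exE conjE) (simp_all only: left right)
  then have "soft_subbase E (Z \<times> W) ?S (soft_prod_topology E Z \<eta> W \<theta>)"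
    unfolding soft_prod_topology_def by (rule soft_subbase_generated)
  then have sub: "?S \<subseteq> soft_prod_topology E Z \<eta> W \<theta>"
    unfolding soft_subbase_def by (rule conjunct1)
  have "(\<lambda>\<alpha>. F \<alpha> \<times> W) \<in> soft_prod_topology E Z \<eta> W \<theta>"
    by (rule subsetD[OF sub]) (use F in blast)
  moreover have "(\<lambda>\<alpha>. Z \<times> G \<alpha>) \<in> soft_prod_topology E Z \<eta> W \<theta>"
    by (rule subsetD[OF sub]) (use G in blast)
  ultimately have "inf (\<lambda>\<alpha>. F \<alpha> \<times> W) (\<lambda>\<alpha>. Z \<times> G \<alpha>) \<in> soft_prod_topology E Z \<eta> W \<theta>"
    using soft_topology_prod[of E Z W \<eta> \<theta>] unfolding soft_topology_def by blast
  moreover have "inf (\<lambda>\<alpha>. F \<alpha> \<times> W) (\<lambda>\<alpha>. Z \<times> G \<alpha>) = (\<lambda>\<alpha>. F \<alpha> \<times> G \<alpha>)"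
    using soft_open_subset[OF \<eta> F] soft_open_subset[OF \<theta> G] by (intro ext) auto
  ultimately show ?thesis by simp
qed

text \<open>
  Every subbasic cylinder is itself a box, one factor being the whole soft set, and boxes are closed
  under binary intersection. Hence finite intersections of cylinders contain a box around each of
  their soft points, and so do unions of these.
\<close>

lemma soft_prod_open_contains_box:
  assumes \<eta>: "soft_topology E Z \<eta>" and \<theta>: "soft_topology E W \<theta>"
    and H: "H \<in> soft_prod_topology E Z \<eta> W \<theta>" and p: "(z, w) \<in> H \<alpha>"
  obtains F G where "F \<in> \<eta>" "G \<in> \<theta>" "z \<in> F \<alpha>" "w \<in> G \<alpha>" "(\<lambda>\<beta>. F \<beta> \<times> G \<beta>) \<le> H"
proof -
  let ?S = "{(\<lambda>\<alpha>. F \<alpha> \<times> W) | F. F \<in> \<eta>} \<union> {(\<lambda>\<alpha>. Z \<times> G \<alpha>) | G. G \<in> \<theta>}"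
  let ?box = "\<lambda>C. \<exists>F\<in>\<eta>. \<exists>G\<in>\<theta>. z \<in> F \<alpha> \<and> w \<in> G \<alpha> \<and> (\<lambda>\<beta>. F \<beta> \<times> G \<beta>) \<le> C"
  have whole: "soft_whole E Z \<in> \<eta>" "soft_whole E W \<in> \<theta>"
    using \<eta> \<theta> unfolding soft_topology_def by blast+
  have \<alpha>: "\<alpha> \<in> E" and zw: "z \<in> Z" "w \<in> W"
    using soft_open_param[OF soft_topology_prod H p] soft_open_subset[OF soft_topology_prod H] p
    by blast+
  have cylinder: "?box C" if C: "C \<in> ?S" "(z, w) \<in> C \<alpha>" for C
  proof -
    from C(1) consider (left) F where "F \<in> \<eta>" "C = (\<lambda>\<alpha>. F \<alpha> \<times> W)"
      | (right) G where "G \<in> \<theta>" "C = (\<lambda>\<alpha>. Z \<times> G \<alpha>)" by blast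
    then show ?thesis
    proof cases
      case left
      then have "z \<in> F \<alpha>" "w \<in> soft_whole E W \<alpha>" "(\<lambda>\<beta>. F \<beta> \<times> soft_whole E W \<beta>) \<le> C"
        using C(2) \<alpha> unfolding soft_whole_def le_fun_def by auto
      then show ?thesis using left(1) whole(2) by (intro bexI conjI)
    next
      case right
      then have "z \<in> soft_whole E Z \<alpha>" "w \<in> G \<alpha>" "(\<lambda>\<beta>. soft_whole E Z \<beta> \<times> G \<beta>) \<le> C"
        using C(2) \<alpha> unfolding soft_whole_def le_fun_def by auto
      then show ?thesis using right(1) whole(1) by (intro bexI conjI)
    qed
  qed
  have inf_box: "?box (inf C D)" if boxes: "?box C" "?box D" for C D
  proof -
    obtain F G where C: "F \<in> \<eta>" "G \<in> \<theta>" "z \<in> F \<alpha>" "w \<in> G \<alpha>" "(\<lambda>\<beta>. F \<beta> \<times> G \<beta>) \<le> C"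
      using boxes(1) by (elim bexE conjE)
    obtain F' G' where D: "F' \<in> \<eta>" "G' \<in> \<theta>" "z \<in> F' \<alpha>" "w \<in> G' \<alpha>" "(\<lambda>\<beta>. F' \<beta> \<times> G' \<beta>) \<le> D"
      using boxes(2) by (elim bexE conjE)
    have "inf F F' \<in> \<eta>" "inf G G' \<in> \<theta>"
      using C D \<eta> \<theta> unfolding soft_topology_def by blast+
    moreover have "z \<in> inf F F' \<alpha>" "w \<in> inf G G' \<alpha>"
      using C D by auto
    moreover have "(\<lambda>\<beta>. inf F F' \<beta> \<times> inf G G' \<beta>) \<le> inf C D"
    proof (rule le_funI)
      fix \<beta>
      show "inf F F' \<beta> \<times> inf G G' \<beta> \<le> inf C D \<beta>"
        using le_funD[OF C(5), of \<beta>] le_funD[OF D(5), of \<beta>] by auto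
    qed
    ultimately show ?thesis by (intro bexI conjI)
  qed
  have finite_inter: "?box (inf (soft_whole E (Z \<times> W)) (Inf \<F>))"
    if "finite \<F>" "\<F> \<subseteq> ?S" "\<And>C. C \<in> \<F> \<Longrightarrow> (z, w) \<in> C \<alpha>" for \<F>
    using that
  proof (induction rule: finite_induct)
    case empty
    have "z \<in> soft_whole E Z \<alpha>" "w \<in> soft_whole E W \<alpha>"
      "(\<lambda>\<beta>. soft_whole E Z \<beta> \<times> soft_whole E W \<beta>) \<le> inf (soft_whole E (Z \<times> W)) (Inf {})"
      using \<alpha> zw unfolding soft_whole_def le_fun_def by auto
    then show ?case using whole by (intro bexI conjI)
  next
    case (insert C \<F>)
    have "?box C"
      by (rule cylinder) (use insert.prems in blast)+
    moreover have "?box (inf (soft_whole E (Z \<times> W)) (Inf \<F>))"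
      by (rule insert.IH) (use insert.prems in blast)+
    ultimately have "?box (inf C (inf (soft_whole E (Z \<times> W)) (Inf \<F>)))"
      by (rule inf_box)
    then show ?case by (simp only: Inf_insert inf.left_commute)
  qed
  obtain \<B> where \<B>: "\<B> \<subseteq> soft_finite_inters E (Z \<times> W) ?S" "H = Sup \<B>"
    using H unfolding soft_prod_topology_def soft_generated_def by blast
  then obtain B where B: "B \<in> \<B>" "(z, w) \<in> B \<alpha>"
    using p by auto
  then have "B \<in> soft_finite_inters E (Z \<times> W) ?S" using \<B>(1) by blast
  then obtain \<F> where \<F>: "finite \<F>" "\<F> \<subseteq> ?S" "B = inf (soft_whole E (Z \<times> W)) (Inf \<F>)"
    unfolding soft_finite_inters_def by blast
  have "?box B"
    unfolding \<F>(3) by (rule finite_inter[OF \<F>(1,2)]) (use B(2) \<F>(3) in auto)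
  then obtain F G where FG: "F \<in> \<eta>" "G \<in> \<theta>" "z \<in> F \<alpha>" "w \<in> G \<alpha>"
    and box: "(\<lambda>\<beta>. F \<beta> \<times> G \<beta>) \<le> B"
    by (elim bexE conjE)
  have "B \<le> H" using B(1) \<B>(2) by (simp add: Sup_upper)
  from that[OF FG order_trans[OF box this]] show thesis .
qed

lemma soft_continuous_swap_prod:
  assumes \<tau>: "soft_topology E X \<tau>" and \<rho>: "soft_topology E W \<rho>" and \<eta>: "soft_topology E Z \<eta>"
    and g: "soft_continuous E X \<tau> W \<rho> g"
  shows "soft_continuous E (Z \<times> X) (soft_prod_topology E Z \<eta> X \<tau>)
    (W \<times> Z) (soft_prod_topology E W \<rho> Z \<eta>) (\<lambda>(z, x). (g x, z))"
  unfolding soft_continuous_iff_open[OF soft_topology_prod soft_topology_prod]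
proof (intro conjI ballI allI impI)
  show "(\<lambda>(z, x). (g x, z)) \<in> Z \<times> X \<rightarrow> W \<times> Z"
    using g unfolding soft_continuous_def by auto
next
  fix p \<alpha> H
  assume p: "p \<in> Z \<times> X" and H: "H \<in> soft_prod_topology E W \<rho> Z \<eta>"
    and mem: "(case p of (z, x) \<Rightarrow> (g x, z)) \<in> H \<alpha>"
  obtain z x where zx: "p = (z, x)" "x \<in> X" using p by blast
  then have "(g x, z) \<in> H \<alpha>" using mem by simp
  then obtain F G where FG: "F \<in> \<rho>" "G \<in> \<eta>" "g x \<in> F \<alpha>" "z \<in> G \<alpha>"
    and box: "(\<lambda>\<beta>. F \<beta> \<times> G \<beta>) \<le> H"
    using soft_prod_open_contains_box[OF \<rho> \<eta> H] by blast
  obtain K where K: "K \<in> \<tau>" "x \<in> K \<alpha>" "soft_image g K \<le> F"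
    using g zx(2) FG unfolding soft_continuous_iff_open[OF \<tau> \<rho>] by blast
  have "(\<lambda>\<beta>. G \<beta> \<times> K \<beta>) \<in> soft_prod_topology E Z \<eta> X \<tau>"
    by (rule soft_box_open[OF \<eta> \<tau> FG(2) K(1)])
  moreover have "p \<in> G \<alpha> \<times> K \<alpha>" using zx FG K by simp
  moreover have "soft_image (\<lambda>(z, x). (g x, z)) (\<lambda>\<beta>. G \<beta> \<times> K \<beta>) \<le> H"
  proof (rule le_funI)
    fix \<beta>
    show "soft_image (\<lambda>(z, x). (g x, z)) (\<lambda>\<beta>. G \<beta> \<times> K \<beta>) \<beta> \<le> H \<beta>"
      using le_funD[OF K(3), of \<beta>] le_funD[OF box, of \<beta>] unfolding soft_image_def by auto
  qed
  ultimately show "\<exists>F\<in>soft_prod_topology E Z \<eta> X \<tau>.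
      p \<in> F \<alpha> \<and> soft_image (\<lambda>(z, x). (g x, z)) F \<le> H"
    by (intro bexI conjI)
qed

theorem theorem7:
  fixes E :: "'e set"
    and X :: "'a set" and \<tau> :: "('e, 'a) soft set"
    and Y :: "'b set" and \<tau>' :: "('e, 'b) soft set"
    and Z :: "'c set" and \<tau>'' :: "('e, 'c) soft set"
  assumes "soft_topology E X \<tau>"
    and "soft_topology E Y \<tau>'"
    and "soft_topology E Z \<tau>''"
    and "soft_continuous E
           (soft_maps E Z \<tau>'' Y \<tau>' \<times> Z)
           (soft_prod_topology E (soft_maps E Z \<tau>'' Y \<tau>') (soft_pointwise E Z \<tau>'' Y \<tau>') Z \<tau>'')
           Y \<tau>' (\<lambda>(f, z). f z)"
  shows "\<forall>g :: 'a \<Rightarrow> 'c \<Rightarrow> 'b.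
           soft_continuous E X \<tau> (soft_maps E Z \<tau>'' Y \<tau>') (soft_pointwise E Z \<tau>'' Y \<tau>') g \<longrightarrow>
           soft_continuous E (Z \<times> X) (soft_prod_topology E Z \<tau>'' X \<tau>) Y \<tau>' (exp_inverse g)"
proof (intro allI impI)
  fix g :: "'a \<Rightarrow> 'c \<Rightarrow> 'b"
  assume "soft_continuous E X \<tau> (soft_maps E Z \<tau>'' Y \<tau>') (soft_pointwise E Z \<tau>'' Y \<tau>') g"
  moreover have "soft_topology E (soft_maps E Z \<tau>'' Y \<tau>') (soft_pointwise E Z \<tau>'' Y \<tau>')"
    unfolding soft_pointwise_def by (rule soft_topology_generated)
  ultimately have "soft_continuous E (Z \<times> X) (soft_prod_topology E Z \<tau>'' X \<tau>)
      (soft_maps E Z \<tau>'' Y \<tau>' \<times> Z)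
      (soft_prod_topology E (soft_maps E Z \<tau>'' Y \<tau>') (soft_pointwise E Z \<tau>'' Y \<tau>') Z \<tau>'')
      (\<lambda>(z, x). (g x, z))"
    using assms(1,3) by (intro soft_continuous_swap_prod)
  from soft_continuous_compose[OF this assms(4)]
  have "soft_continuous E (Z \<times> X) (soft_prod_topology E Z \<tau>'' X \<tau>) Y \<tau>'
      ((\<lambda>(f, z). f z) \<circ> (\<lambda>(z, x). (g x, z)))" .
  moreover have "(\<lambda>(f, z). f z) \<circ> (\<lambda>(z, x). (g x, z)) = exp_inverse g"
    by (auto simp: exp_inverse_def)
  ultimately show "soft_continuous E (Z \<times> X) (soft_prod_topology E Z \<tau>'' X \<tau>) Y \<tau>' (exp_inverse g)"
    by simp
qed

end
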